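(* Let $X\in\mathbb R^{n\times q}$ be of rank $q<n$ and let $P = I_n - X(X^TX)^{-1}X^T$. Let $\mathcal G$ be the group of transformations on $\mathbb R^{n\times p}$ of the form $g(Y) = XC^T + YA^T$ for $C\in\mathbb R^{p\times q}$ and nonsingular $A\in\mathbb R^{p\times p}$. For $Y\in\mathbb R^{n\times p}$ put $R = PY$. Then the function $M(Y) = R(R^TR)^{-}R^T$ is maximal invariant with respect to $\mathcal G$.
   Context: For a square matrix $S$, $S^{-}$ denotes the inverse of $S$ if $S$ is nonsingular, and the Moore-Penrose inverse of $S$ otherwise. A function $M$ on $\mathbb R^{n\times p}$ is invariant under $\mathcal G$ if $M(g(Y)) = M(Y)$ for all $g\in\mathcal G$ and all $Y$; it is maximal invariant if it is invariant and, for all $Y, Y_1\in\mathbb R^{n\times p}$, $M(Y_1)=M(Y)$ implies $Y_1 = g(Y)$ for some $g\in\mathcal G$. *)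

theory Defs
  imports "HOL-Analysis.Analysis"
begin

text \<open>The four Penrose equations, which determine \<open>G\<close> uniquely.\<close>

definition is_moore_penrose :: "real^'n^'m \<Rightarrow> real^'m^'n \<Rightarrow> bool" where
  "is_moore_penrose S G \<longleftrightarrow>
     S ** G ** S = S \<and> G ** S ** G = G \<and>
     transpose (S ** G) = S ** G \<and> transpose (G ** S) = G ** S"

definition moore_penrose_inv :: "real^'n^'m \<Rightarrow> real^'m^'n" where
  "moore_penrose_inv S = (THE G. is_moore_penrose S G)"

definition minus_inv :: "real^'n^'n \<Rightarrow> real^'n^'n" where
  "minus_inv S = (if invertible S then matrix_inv S else moore_penrose_inv S)"

definition invariant_under :: "('a \<Rightarrow> 'a) set \<Rightarrow> ('a \<Rightarrow> 'b) \<Rightarrow> bool" where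
  "invariant_under \<G> M \<longleftrightarrow> (\<forall>g\<in>\<G>. \<forall>Y. M (g Y) = M Y)"

definition maximal_invariant :: "('a \<Rightarrow> 'a) set \<Rightarrow> ('a \<Rightarrow> 'b) \<Rightarrow> bool" where
  "maximal_invariant \<G> M \<longleftrightarrow>
     invariant_under \<G> M \<and> (\<forall>Y Y1. M Y1 = M Y \<longrightarrow> (\<exists>g\<in>\<G>. Y1 = g Y))"

text \<open>In \<open>real^'q^'n\<close> the row index type \<open>'n\<close> comes last: these are the
  \<open>n \<times> q\<close> matrices.\<close>

definition transformations :: "real^'q^'n \<Rightarrow> (real^'p^'n \<Rightarrow> real^'p^'n) set" where
  "transformations X =
     {g. \<exists>(C :: real^'q^'p) (A :: real^'p^'p). invertible A \<and>
          g = (\<lambda>Y. X ** transpose C + Y ** transpose A)}"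

definition residual_projection :: "real^'q^'n \<Rightarrow> real^'n^'n" where
  "residual_projection X = mat 1 - X ** matrix_inv (transpose X ** X) ** transpose X"

definition residuals :: "real^'q^'n \<Rightarrow> real^'p^'n \<Rightarrow> real^'p^'n" where
  "residuals X Y = residual_projection X ** Y"

definition inv_stat :: "real^'q^'n \<Rightarrow> real^'p^'n \<Rightarrow> real^'n^'n" where
  "inv_stat X Y = (let R = residuals X Y in
     R ** minus_inv (transpose R ** R) ** transpose R)"

end

theory Submission
  imports Defs
begin

text \<open>\<open>inv_stat X Y\<close> is the orthogonal projection onto the column space of \<open>R = P Y\<close>. Since
  \<open>P X = 0\<close>, a transformation replaces \<open>R\<close> by \<open>R A\<^sup>T\<close>, which leaves the column space unchanged.
  Conversely, two matrices with the same column space differ by an invertible right factor.\<close>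

lemma matrix_sub_ldistrib: "(A :: real^'n^'m) ** (B - C) = A ** B - A ** C"
  by (simp add: matrix_eq matrix_vector_mul_assoc [symmetric] algebra_simps)

lemma matrix_sub_rdistrib: "((A :: real^'n^'m) - B) ** C = A ** C - B ** C"
  by (simp add: matrix_eq matrix_vector_mul_assoc [symmetric] algebra_simps)

lemma matrix_add_rdistrib: "((A :: real^'n^'m) + B) ** C = A ** C + B ** C"
  by (simp add: matrix_eq matrix_vector_mul_assoc [symmetric] algebra_simps)

section \<open>Gram matrices and generalized inverses\<close>

lemma gram_mult_vec_eq_0:
  fixes R :: "real^'p^'n"
  assumes "(transpose R ** R) *v x = 0"
  shows "R *v x = 0"
proof -
  have "(R *v x) \<bullet> (R *v x) = x \<bullet> (transpose R *v (R *v x))"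
    by (metis dot_lmul_matrix transpose_matrix_vector inner_commute)
  also have "\<dots> = 0"
    using assms by (simp only: matrix_vector_mul_assoc inner_zero_right)
  finally show ?thesis by simp
qed

text \<open>Since |R x|^2 equals the inner product of x with R^T R x, a left factor
  \<open>transpose R\<close> can be cancelled here.\<close>

lemma gram_mult_eq_0:
  fixes R :: "real^'p^'n"
  assumes "transpose R ** R ** Z = 0"
  shows "R ** Z = 0"
proof -
  have "R *v (Z *v x) = 0" for x
    by (rule gram_mult_vec_eq_0) (use assms in \<open>simp add: matrix_vector_mul_assoc\<close>)
  then show ?thesis
    by (simp add: matrix_eq matrix_vector_mul_assoc)
qed

text \<open>Cancelling \<open>transpose R\<close> in R^T R (G R^T R - 1) = 0 gives the first claim.
  Thus every generalized inverse G of the Gram matrix, symmetric or not, makes R G R^T the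
  orthogonal projection onto the column space of R.\<close>

lemma gram_ginverse:
  fixes R :: "real^'p^'n"
  assumes "transpose R ** R ** G ** (transpose R ** R) = transpose R ** R"
  shows "R ** G ** transpose R ** R = R"
    and "transpose (R ** G ** transpose R) = R ** G ** transpose R"
proof -
  have "transpose R ** R ** (G ** (transpose R ** R) - mat 1) = 0"
    using assms by (simp add: matrix_sub_ldistrib matrix_mul_assoc)
  from gram_mult_eq_0 [OF this] show *: "R ** G ** transpose R ** R = R"
    by (simp add: matrix_sub_ldistrib matrix_mul_assoc)
  \<comment> \<open>\<open>H R = R\<close> gives \<open>H H\<^sup>T = H\<close> for \<open>H = R G R\<^sup>T\<close>.\<close>
  define H where "H = R ** G ** transpose R"
  have "H ** transpose H = R ** G ** transpose (H ** R)"
    by (simp add: H_def matrix_transpose_mul matrix_mul_assoc)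
  then have "H ** transpose H = H"
    using * by (simp add: H_def)
  then show "transpose (R ** G ** transpose R) = R ** G ** transpose R"
    unfolding H_def [symmetric] by (metis matrix_transpose_mul transpose_transpose)
qed

lemma ginverse_exists:
  fixes S :: "real^'n^'m"
  obtains G where "S ** G ** S = S"
proof -
  \<comment> \<open>A linear right inverse of S on its range; its matrix is the required G.\<close>
  obtain g where "Vector_Spaces.linear (*s) (*s) g" and g: "\<forall>v\<in>range ((*v) S). S *v g v = v"
    using vec.linear_exists_right_inverse_on [OF matrix_vector_mul_linear_gen vec.subspace_UNIV]
    by blast
  then have "S ** matrix g ** S = S"
    by (simp add: matrix_eq matrix_vector_mul_assoc [symmetric] matrix_works)
  then show ?thesis by (rule that)
qed

lemma orthogonal_projection_exists:
  fixes R :: "real^'p^'n"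
  obtains K where "R ** K ** R = R" "transpose (R ** K) = R ** K"
proof -
  obtain G where "transpose R ** R ** G ** (transpose R ** R) = transpose R ** R"
    by (rule ginverse_exists)
  from gram_ginverse [OF this] show ?thesis
    by (intro that [of "G ** transpose R"]) (simp_all add: matrix_mul_assoc)
qed

section \<open>The Moore-Penrose inverse\<close>

lemma is_moore_penrose_unique:
  assumes "is_moore_penrose S G" "is_moore_penrose S H"
  shows "G = H"
proof -
  have G: "S ** G ** S = S" "G ** S ** G = G" "transpose (S ** G) = S ** G"
      "transpose (G ** S) = G ** S"
    and H: "S ** H ** S = S" "H ** S ** H = H" "transpose (S ** H) = S ** H"
      "transpose (H ** S) = H ** S"
    using assms by (simp_all add: is_moore_penrose_def)
  \<comment> \<open>S G and S H are orthogonal projections onto the column space of S, so they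
    agree. By the same argument G S and H S agree.\<close>
  have "S ** G = transpose (S ** H ** (S ** G))"
    using G H by (metis matrix_mul_assoc)
  also have "\<dots> = S ** G ** (S ** H)"
    using G H by (metis matrix_transpose_mul)
  also have "\<dots> = S ** H"
    using G by (metis matrix_mul_assoc)
  finally have l: "S ** G = S ** H" .
  have "G ** S = transpose (G ** S ** (H ** S))"
    using G H by (metis matrix_mul_assoc)
  also have "\<dots> = H ** S ** (G ** S)"
    using G H by (metis matrix_transpose_mul)
  also have "\<dots> = H ** S"
    using G by (metis matrix_mul_assoc)
  finally have r: "G ** S = H ** S" .
  have "G = G ** (S ** G)"
    using G by (simp add: matrix_mul_assoc)
  also have "\<dots> = H ** S ** H"
    unfolding l by (simp add: matrix_mul_assoc r)
  finally show ?thesis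
    using H by simp
qed

lemma is_moore_penrose_exists:
  fixes S :: "real^'n^'m"
  obtains G where "is_moore_penrose S G"
proof -
  obtain G where G: "S ** G ** S = S"
    by (rule ginverse_exists)
  obtain K where K: "S ** K ** S = S" "transpose (S ** K) = S ** K"
    by (rule orthogonal_projection_exists)
  obtain L where L: "transpose S ** L ** transpose S = transpose S"
      "transpose (transpose S ** L) = transpose S ** L"
    by (rule orthogonal_projection_exists)
  \<comment> \<open>Q is the orthogonal projection onto the row space of S, as S K is onto the
    column space.\<close>
  define Q where "Q = transpose S ** L"
  have QQ: "Q ** Q = Q"
    unfolding Q_def using L by (simp add: matrix_mul_assoc)
  have Q: "transpose Q = Q" "S ** Q = S"
    unfolding Q_def using L by (metis matrix_transpose_mul transpose_transpose)+
  have QGS: "Q ** G ** S = Q"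
  proof -
    have "Q = transpose L ** S"
      using Q by (metis Q_def matrix_transpose_mul transpose_transpose)
    then show ?thesis
      using G by (metis matrix_mul_assoc)
  qed
  \<comment> \<open>Cutting G down by the two projections leaves a generalized inverse whose
    products with S are exactly these projections.\<close>
  define M where "M = Q ** G ** (S ** K)"
  have SM: "S ** M = S ** K"
    unfolding M_def using Q(2) G by (metis matrix_mul_assoc)
  have MS: "M ** S = Q"
    unfolding M_def using K(1) QGS by (metis matrix_mul_assoc)
  have "is_moore_penrose S M"
    unfolding is_moore_penrose_def SM MS
    using K Q QQ by (simp add: M_def matrix_mul_assoc)
  then show ?thesis by (rule that)
qed

lemma moore_penrose_inv_ginverse: "S ** moore_penrose_inv S ** S = S"
proof -
  obtain G where "is_moore_penrose S G"
    by (rule is_moore_penrose_exists)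
  then have "is_moore_penrose S (moore_penrose_inv S)"
    unfolding moore_penrose_inv_def by (auto intro: theI is_moore_penrose_unique)
  then show ?thesis
    by (simp add: is_moore_penrose_def)
qed

lemma matrix_inv_mult:
  assumes "invertible A"
  shows "A ** matrix_inv A = mat 1" "matrix_inv A ** A = mat 1"
  using someI_ex [OF assms [unfolded invertible_def]] unfolding matrix_inv_def by auto

text \<open>This puts both cases of \<open>minus_inv\<close> in the scope of
  \<open>gram_ginverse\<close>.\<close>

lemma minus_inv_ginverse: "S ** minus_inv S ** S = S"
  by (simp add: minus_inv_def matrix_inv_mult moore_penrose_inv_ginverse)

section \<open>Kernels and column spaces\<close>

lemma dim_kernel:
  fixes R :: "real^'p^'n"
  shows "dim {x. R *v x = 0} + rank R = CARD('p)"
proof -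
  \<comment> \<open>The kernel is the orthogonal complement of the row space, whose dimension is the
    rank.\<close>
  have "{x. R *v x = 0} = {y \<in> UNIV. \<forall>x \<in> range (\<lambda>z. transpose R *v z). orthogonal x y}"
  proof -
    have "orthogonal (transpose R *v z) y \<longleftrightarrow> z \<bullet> (R *v y) = 0" for y z
      by (simp add: orthogonal_def dot_lmul_matrix)
    moreover have "R *v y = 0 \<longleftrightarrow> (\<forall>z. z \<bullet> (R *v y) = 0)" for y
      by (metis inner_eq_zero_iff inner_zero_right)
    ultimately show ?thesis by auto
  qed
  moreover have "subspace (range (\<lambda>z. transpose R *v z))"
    by (intro linear_subspace_image matrix_vector_mul_linear subspace_UNIV)
  ultimately have "dim {x. R *v x = 0} + dim (range (\<lambda>z. transpose R *v z)) = CARD('p)"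
    using dim_subspace_orthogonal_to_vectors [of "range (\<lambda>z. transpose R *v z)" UNIV] by simp
  then show ?thesis
    using rank_dim_range [of "transpose R"] rank_transpose [of R] by simp
qed

lemma same_column_space_invertible_factor:
  fixes R R1 :: "real^'p^'n"
  assumes R1: "R1 = R ** K" and R: "R = R1 ** L"
  obtains B where "invertible B" "R1 = R ** B"
proof -
  obtain G where G: "R ** G ** R = R"
    by (rule ginverse_exists)
  obtain G1 where G1: "R1 ** G1 ** R1 = R1"
    by (rule ginverse_exists)
  have "range ((*v) R) = range ((*v) R1)"
  proof
    show "range ((*v) R) \<subseteq> range ((*v) R1)"
      by (subst R) (auto simp: matrix_vector_mul_assoc [symmetric])
    show "range ((*v) R1) \<subseteq> range ((*v) R)"
      by (subst R1) (auto simp: matrix_vector_mul_assoc [symmetric])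
  qed
  then have "rank R = rank R1"
    by (simp add: rank_dim_range)
  then have "dim {x. R1 *v x = 0} = dim {x. R *v x = 0}"
    using dim_kernel [of R] dim_kernel [of R1] by simp
  moreover have "subspace {x. M *v x = 0}" for M :: "real^'p^'n"
    by (intro linear_subspace_kernel matrix_vector_mul_linear)
  \<comment> \<open>Equal ranks make the kernels equidimensional, hence isomorphic.\<close>
  ultimately obtain u where "linear u" and u: "u ` {x. R1 *v x = 0} = {x. R *v x = 0}"
    and inj: "inj_on u {x. R1 *v x = 0}"
    using subspace_isomorphism by blast
  define U where "U = matrix u"
  have U: "U *v x = u x" for x
    using \<open>linear u\<close> by (simp add: U_def matrix_vector_mul)
  \<comment> \<open>\<open>G R1\<close> already satisfies \<open>R (G R1) = R1\<close>; the second summand makes it injective by carrying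
    the kernel of \<open>R1\<close> isomorphically onto that of \<open>R\<close>.\<close>
  define B where "B = G ** R1 + U ** (mat 1 - G1 ** R1)"
  have ker: "R *v (U *v x) = 0" if "R1 *v x = 0" for x
    using u that U by auto
  have G1': "R1 *v (x - G1 *v (R1 *v x)) = 0" for x
    using G1 by (simp add: algebra_simps matrix_vector_mul_assoc matrix_mul_assoc)
  have Bv: "B *v x = G *v (R1 *v x) + U *v (x - G1 *v (R1 *v x))" for x
    by (simp add: B_def algebra_simps matrix_vector_mul_assoc [symmetric])
  have RG: "R *v (G *v (R1 *v x)) = R1 *v x" for x
    using G by (simp add: R1 matrix_vector_mul_assoc matrix_mul_assoc)
  have RB: "R *v (B *v x) = R1 *v x" for x
    unfolding Bv matrix_vector_right_distrib RG ker [OF G1'] by simp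
  \<comment> \<open>If B x = 0, then R1 x = R B x = 0, so B x reduces to u x, and u is injective on
    the kernel of R1.\<close>
  have "x = 0" if "B *v x = 0" for x
  proof -
    have x: "R1 *v x = 0"
      using RB [of x] that by simp
    then have "u x = u 0"
      using that \<open>linear u\<close> by (simp add: Bv U linear_0)
    then show ?thesis
      using inj x by (auto simp: inj_on_def)
  qed
  then have "invertible B"
    by (simp add: invertible_left_inverse matrix_left_invertible_ker)
  moreover have "R1 = R ** B"
    by (simp add: matrix_eq matrix_vector_mul_assoc [symmetric] RB)
  ultimately show ?thesis by (rule that)
qed

section \<open>Residuals and the projection \<open>inv_stat\<close>\<close>

lemma residual_projection_mult:
  fixes X :: "real^'q^'n"
  assumes "rank X = CARD('q)"
  shows "residual_projection X ** X = 0"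
proof -
  \<comment> \<open>Full column rank makes the Gram matrix of X invertible, so
    \<open>matrix_inv\<close> is a true inverse.\<close>
  have "inj ((*v) X)"
    using assms by (simp add: full_rank_injective)
  then have "\<forall>x. (transpose X ** X) *v x = 0 \<longrightarrow> x = 0"
    by (metis gram_mult_vec_eq_0 vec.inj_iff_eq_0)
  then have "invertible (transpose X ** X)"
    by (simp only: invertible_left_inverse matrix_left_invertible_ker)
  then have "X ** (matrix_inv (transpose X ** X) ** (transpose X ** X)) = X"
    by (simp add: matrix_inv_mult)
  then show ?thesis
    by (simp add: residual_projection_def matrix_sub_rdistrib matrix_mul_assoc)
qed

lemma residuals_decomposition:
  obtains D where "Y = residuals X Y + X ** D"
proof
  show "Y = residuals X Y + X ** (matrix_inv (transpose X ** X) ** transpose X ** Y)"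
    by (simp add: residuals_def residual_projection_def matrix_sub_rdistrib matrix_mul_assoc)
qed

lemma inv_stat_projection:
  fixes Y :: "real^'p^'n"
  shows "inv_stat X Y ** residuals X Y = residuals X Y"
    and "transpose (inv_stat X Y) = inv_stat X Y"
    and "\<exists>K. inv_stat X Y = residuals X Y ** K"
  unfolding inv_stat_def Let_def
  using gram_ginverse [OF minus_inv_ginverse] by (auto simp: matrix_mul_assoc [symmetric])

text \<open>Each projection fixes the columns of the other, so H H' = H' and H' H = H. Transposing
  the second equation gives H H' = H.\<close>

lemma symmetric_projection_unique:
  fixes H H' :: "real^'n^'n"
  assumes "H ** R = R" "transpose H = H" "H = R ** K"
    and "H' ** R' = R'" "transpose H' = H'" "H' = R' ** K'"
    and "R' = R ** L" "R = R' ** L'"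
  shows "H = H'"
proof -
  have "H ** H' = H'" "H' ** H = H"
    using assms by (metis matrix_mul_assoc)+
  then show ?thesis
    using assms by (metis matrix_transpose_mul)
qed

theorem theorem1:
  fixes X :: "real^'q^'n"
  assumes "rank X = CARD('q)" and "CARD('q) < CARD('n)"
  shows "maximal_invariant
           (transformations X :: (real^'p^'n \<Rightarrow> real^'p^'n) set)
           (inv_stat X :: real^'p^'n \<Rightarrow> real^'n^'n)"
  unfolding maximal_invariant_def invariant_under_def
proof (intro conjI ballI allI impI)
  fix g :: "real^'p^'n \<Rightarrow> real^'p^'n" and Y
  assume "g \<in> transformations X"
  then obtain C :: "real^'q^'p" and A :: "real^'p^'p" where A: "invertible A"
    and g: "g = (\<lambda>Y. X ** transpose C + Y ** transpose A)"
    unfolding transformations_def by blast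
  have 1: "residuals X (g Y) = residuals X Y ** transpose A"
    by (simp add: residuals_def g matrix_add_ldistrib matrix_mul_assoc
        residual_projection_mult [OF assms(1)])
  \<comment> \<open>Undoing the factor A^T shows that the two residual matrices have the same column
    space.\<close>
  obtain A' where "transpose A ** A' = mat 1"
    using transpose_invertible [OF A] invertible_def by blast
  then have 2: "residuals X Y = residuals X (g Y) ** A'"
    by (simp add: 1 matrix_mul_assoc [symmetric])
  obtain K K' where K: "inv_stat X Y = residuals X Y ** K"
    and K': "inv_stat X (g Y) = residuals X (g Y) ** K'"
    using inv_stat_projection(3) by metis
  show "inv_stat X (g Y) = inv_stat X Y"
    by (rule symmetric_projection_unique
        [OF inv_stat_projection(1,2) K inv_stat_projection(1,2) K' 1 2, symmetric])
next
  fix Y Y1 :: "real^'p^'n"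
  assume eq: "inv_stat X Y1 = inv_stat X Y"
  obtain K K1 where "inv_stat X Y = residuals X Y ** K"
    and "inv_stat X Y1 = residuals X Y1 ** K1"
    using inv_stat_projection(3) by metis
  \<comment> \<open>The common projection fixes both residual matrices and factors through each of
    them.\<close>
  then have "residuals X Y1 = residuals X Y ** (K ** residuals X Y1)"
    and "residuals X Y = residuals X Y1 ** (K1 ** residuals X Y)"
    using eq inv_stat_projection(1) by (metis matrix_mul_assoc)+
  then obtain B where B: "invertible B" "residuals X Y1 = residuals X Y ** B"
    by (rule same_column_space_invertible_factor)
  obtain D where D: "Y = residuals X Y + X ** D"
    by (rule residuals_decomposition)
  obtain D1 where D1: "Y1 = residuals X Y1 + X ** D1"
    by (rule residuals_decomposition)
  \<comment> \<open>Y B and Y1 have the same residual part, so they differ only by a multiple of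
    X.\<close>
  have "Y ** B = residuals X Y1 + X ** D ** B"
    by (subst D) (simp add: matrix_add_rdistrib B(2))
  then have Y1: "Y1 = X ** (D1 - D ** B) + Y ** B"
    using D1 by (simp add: matrix_sub_ldistrib matrix_mul_assoc add.commute)
  \<comment> \<open>The witnesses are C = (D1 - D B)^T and A = B^T, since transformations act
    through transposes.\<close>
  have "(\<lambda>Y. X ** transpose (transpose (D1 - D ** B)) + Y ** transpose (transpose B))
      \<in> transformations X"
    unfolding transformations_def using transpose_invertible [OF B(1)] by blast
  then show "\<exists>g\<in>transformations X. Y1 = g Y"
    using Y1 by (auto intro!: bexI)
qed

end
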